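(* Let $\chi$ be a weight function and $\varphi=\varphi_\chi$ its transform. Let $n\ge 1$ be an integer and assume that, as $|x|\to\infty$, $$\varphi(x)=\frac{g_0(x)}{x^n}+o\!\left(\frac1{x^n}\right),\qquad \varphi'(x)=\frac{g_1(x)}{x^n}+o\!\left(\frac1{x^n}\right),\qquad \varphi''(x)=\frac{g_2(x)}{x^n}+o\!\left(\frac1{x^n}\right),$$ where $g_0,g_1,g_2:\mathbb{R}\to\mathbb{R}$ are bounded on $\mathbb{R}$. Let $d\ge1$, $\nu=(\nu_1,\dots,\nu_d)\in\mathbb{R}^d$, $K=\mathbb{Z}^d\setminus\{(1,0,\dots,0)\}$, and let $$f(t)=e^{i\nu_1t}+\sum_{k\in K}a_k e^{i\langle k,\nu\rangle t},\qquad a_k\in\mathbb{C},$$ be a quasiperiodic function on $\mathbb{R}$. For $k\in K$ put $\Omega_k=\langle k,\nu\rangle-\nu_1$, and assume that $\sum_{k\in K}\left|\frac{a_k}{\Omega_k^p}\right|$ is convergent for $p=0$, $p=1$ and $p=n$. For $T>0$ let $\nu_1^T$ be the frequency map approximation of $\nu_1$, i.e. a value of $\sigma$ at which $|\langle f(t),e^{i\sigma t}\rangle_T^\chi|$ is maximum in a fixed, sufficiently small neighborhood of $\nu_1$ (as made precise in the context). Then, for $T\to+\infty$, $\nu_1^T\to\nu_1$ and $$\nu_1-\nu_1^T=\frac{-1}{\varphi''(0)\,T^{n+1}}\sum_{k\in K}\frac{\Re(a_k)}{\Omega_k^n}\,g_1(\Omega_kT)+o\!\left(\frac1{T^{n+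1}}\right).$$
   Context: A weight function is a nonnegative, even, $C^\infty$ function $\chi$ on $[-1,1]$ such that $\frac12\int_{-1}^1\chi(t)\,dt=1$. For $T>0$, $$\langle f(t),g(t)\rangle_T^\chi=\frac1{2T}\int_{-T}^T f(t)\,\overline{g(t)}\,\chi(t/T)\,dt .$$ The transform of $\chi$ is the $C^\infty$ function on $\mathbb{R}$ defined by $\varphi_\chi(x)=\langle e^{ixt},1\rangle_1^\chi=\frac12\int_{-1}^1e^{ixt}\chi(t)\,dt$ (it is real valued and even, because $\chi$ is even). Here $\langle k,\nu\rangle=\sum_jk_j\nu_j$. The convergence hypothesis for $p\geq 1$ includes that $\Omega_k\ne0$ whenever $a_k\neq0$; terms with $a_k=0$ are read as $0$. Frequency map approximation $\nu_1^T$: the value of $\sigma$ for which $|\langle f(t),e^{i\sigma t}\rangle_T^\chi|$ is maximum in a neighborhood of $\nu_1$. Precisely: there is $\delta_0>0$ depending on $f$ such that for every fixed $\delta\in(0,\delta_0]$ (independent of $T$), $\nu_1^T$ denotes any point of $[\nu_1-\delta,\nu_1+\delta]$ at which $\sigma\mapsto|\langle f(t),e^{i\sigma t}\rangle_T^\chi|$ attains its maximum over that interval; the conclusion is asserted for each such $\delta$ and any such choice of $\nu_1^T$. *)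

theory Defs
  imports "HOL-Analysis.Analysis" "HOL-Library.Landau_Symbols"
begin

text \<open>Derivatives are taken within \<open>S\<close>, so on a compact interval they are one-sided at the endpoints.\<close>

definition smooth_within :: "(real \<Rightarrow> real) \<Rightarrow> real set \<Rightarrow> bool" where
  "smooth_within h S \<longleftrightarrow>
     (\<exists>D :: nat \<Rightarrow> real \<Rightarrow> real. (\<forall>t\<in>S. D 0 t = h t) \<and>
        (\<forall>m. \<forall>t\<in>S. (D m has_real_derivative D (Suc m) t) (at t within S)))"

text \<open>Only the values of \<open>w\<close> on \<open>[-1,1]\<close> matter here and below.\<close>

definition weight_function :: "(real \<Rightarrow> real) \<Rightarrow> bool" where
  "weight_function w \<longleftrightarrow>
     (\<forall>t\<in>{-1..1}. w t \<ge> 0) \<and>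
     (\<forall>t\<in>{-1..1}. w (- t) = w t) \<and>
     smooth_within w {-1..1} \<and>
     1 / 2 * integral {-1..1} w = 1"

definition weighted_inner ::
    "(real \<Rightarrow> real) \<Rightarrow> real \<Rightarrow> (real \<Rightarrow> complex) \<Rightarrow> (real \<Rightarrow> complex) \<Rightarrow> complex" where
  "weighted_inner w T f g =
     1 / (2 * of_real T) * integral {-T..T} (\<lambda>t. f t * cnj (g t) * of_real (w (t / T)))"

text \<open>Taking the real part loses nothing when \<open>w\<close> is even: see \<open>of_real_weight_transform\<close>.\<close>

definition weight_transform :: "(real \<Rightarrow> real) \<Rightarrow> real \<Rightarrow> real" where
  "weight_transform w x = Re (weighted_inner w 1 (\<lambda>t. cis (x * t)) (\<lambda>t. 1))"

lemma of_real_weight_transform: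
  assumes "weight_function w"
  shows "of_real (weight_transform w x) = weighted_inner w 1 (\<lambda>t. cis (x * t)) (\<lambda>t. 1)"
proof -
  let ?h = "\<lambda>t. cis (x * t) * complex_of_real (w t)"
  have "cnj (integral {-1..1} ?h) = integral {-1..1} (\<lambda>t. cnj (?h t))"
    by (simp add: integral_cnj)
  also have "\<dots> = integral {-1..1} (\<lambda>t. ?h (- t))"
    by (rule integral_cong) (use assms in \<open>simp add: weight_function_def cis_cnj\<close>)
  also have "\<dots> = integral {-1..1} ?h"
    using Henstock_Kurzweil_Integration.integral_reflect_real[where a="-1" and b=1 and f="?h"]
    by (simp only: minus_minus)
  finally have "integral {-1..1} ?h \<in> \<real>"
    by (simp add: Reals_cnj_iff)
  then show ?thesis
    by (simp add: weight_transform_def weighted_inner_def complex_is_Real_iff complex_eq_iff)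
qed

definition pairing :: "int ^ 'd \<Rightarrow> real ^ 'd \<Rightarrow> real" where
  "pairing k \<nu> = (\<Sum>j\<in>UNIV. of_int (k $ j) * \<nu> $ j)"

text \<open>The coordinates are indexed by an arbitrary finite type, and \<open>j\<close> is the coordinate that
  carries the fundamental frequency; the multi-index \<open>(1,0,\<dots>,0)\<close> is therefore \<open>axis j 1\<close>.\<close>

definition other_modes :: "'d \<Rightarrow> (int ^ 'd::finite) set" where
  "other_modes j = UNIV - {axis j 1}"

definition detuning :: "real ^ 'd \<Rightarrow> 'd \<Rightarrow> int ^ 'd \<Rightarrow> real" where
  "detuning \<nu> j k = pairing k \<nu> - \<nu> $ j"

definition quasiperiodic ::
    "real ^ 'd \<Rightarrow> 'd \<Rightarrow> (int ^ 'd \<Rightarrow> complex) \<Rightarrow> real \<Rightarrow> complex" where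
  "quasiperiodic \<nu> j a t =
     cis (\<nu> $ j * t) + (\<Sum>\<^sub>\<infinity>k\<in>other_modes j. a k * cis (pairing k \<nu> * t))"

definition is_frequency_approx ::
    "(real \<Rightarrow> real) \<Rightarrow> (real \<Rightarrow> complex) \<Rightarrow> real \<Rightarrow> real \<Rightarrow> real \<Rightarrow> real \<Rightarrow> bool" where
  "is_frequency_approx w f \<nu>\<^sub>1 \<delta> T s \<longleftrightarrow>
     is_arg_max (\<lambda>\<sigma>. cmod (weighted_inner w T f (\<lambda>t. cis (\<sigma> * t))))
       (\<lambda>\<sigma>. \<sigma> \<in> {\<nu>\<^sub>1 - \<delta>..\<nu>\<^sub>1 + \<delta>}) s"

end

theory Submission imports Defs begin

text \<open>Write \<open>\<phi>\<close> for the transform of the weight \<open>w\<close> and \<open>\<Omega> k\<close> for the detunings, and measure a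
  trial frequency \<open>\<sigma>\<close> in units of the resolution \<open>1 / T\<close>: put \<open>u = (\<nu>\<^sub>1 - \<sigma>) T\<close>. Integrating the
  series of \<open>f\<close> term by term, the quantity whose modulus is maximised becomes
  \<open>G T u = \<phi> u + (\<Sum> a k * \<phi> (\<Omega> k * T + u))\<close> (\<open>weighted_inner_eq_amplitude\<close>): the peak \<open>\<phi> u\<close> of the
  fundamental mode, plus tails of \<open>\<phi>\<close> that come from the other modes and are small because \<open>\<phi>\<close>
  decays at infinity. A maximiser is called \<open>U T\<close> in this variable.

  The maximiser tends to \<open>0\<close> (\<open>maximizer_tendsto_0\<close>). The detunings may accumulate at \<open>0\<close>, so
  however small the search interval is, some modes may have their own peak inside or close to it.
  However, the total weight of the modes with \<open>\<bar>\<Omega> k\<bar> \<le> 2 \<delta>\<close> vanishes as \<open>\<delta> \<rightarrow> 0\<close>; this is what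
  determines \<open>\<delta>\<^sub>0\<close>. Once it is at most \<open>1 / 4\<close>, comparing \<open>G T (U T)\<close> with \<open>G T 0\<close>, which tends to
  \<open>1\<close>, makes \<open>\<bar>\<phi> (U T)\<bar>\<close> at least \<open>1 / 2\<close> for large \<open>T\<close>, hence \<open>U\<close> bounded; then all the other modes become negligible,
  \<open>\<bar>\<phi> (U T)\<bar> \<rightarrow> 1\<close>, and \<open>U T \<rightarrow> 0\<close>, because \<open>\<bar>\<phi>\<bar>\<close> stays away from \<open>1\<close> outside each neighbourhood of
  \<open>0\<close> (\<open>transform_bounded_away_from_1\<close>).

  Now \<open>U T\<close> is an interior maximum of \<open>\<bar>G T\<bar>\<^sup>2\<close>, so \<open>Re G * Re G' + Im G * Im G' = 0\<close> there. As
  \<open>T \<rightarrow> \<infinity>\<close>, \<open>Re G \<rightarrow> 1\<close>, \<open>Im G \<rightarrow> 0\<close> and \<open>\<phi>' (U T) = U T * (\<phi>'' 0 + o(1))\<close>, while the derivative of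
  the tails at \<open>U T\<close> is its value \<open>S T\<close> at \<open>0\<close> plus \<open>U T * o(1)\<close>. So the equation reads
  \<open>U T * (\<phi>'' 0 + o(1)) = - Re (S T) + o(\<bar>S T\<bar>)\<close>. Finally \<open>T ^ n * S T\<close> is bounded and its real part
  is \<open>\<Sum> Re (a k) / \<Omega> k ^ n * g\<^sub>1 (\<Omega> k * T)\<close> up to \<open>o(1)\<close>, by the expansion of \<open>\<phi>'\<close>
  (\<open>modal_sum_leading_term\<close>). Dividing by \<open>\<phi>'' 0 < 0\<close> and by \<open>T ^ (n + 1)\<close> gives the claim
  (\<open>maximizer_expansion\<close>). All exchanges of limit and sum are instances of dominated convergence.\<close>

section \<open>Dominated convergence for unordered series\<close>

text \<open>The terms are dominated uniformly in \<open>y\<close>, so the partial sums converge uniformly by the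
  Weierstrass test, and the two limits may be swapped.\<close>

lemma infsum_dominated_convergence:
  fixes f :: "'a \<Rightarrow> 'b \<Rightarrow> 'c::banach"
  assumes lim: "\<And>k. k \<in> K \<Longrightarrow> (f k \<longlongrightarrow> l k) F"
    and bound: "\<forall>\<^sub>F y in F. \<forall>k\<in>K. norm (f k y) \<le> M k"
    and M: "M summable_on K"
  shows "((\<lambda>y. \<Sum>\<^sub>\<infinity>k\<in>K. f k y) \<longlongrightarrow> (\<Sum>\<^sub>\<infinity>k\<in>K. l k)) F"
proof (cases "F = bot")
  case False
  have "norm (l k) \<le> M k" if "k \<in> K" for k
  proof (rule tendsto_upperbound[OF tendsto_norm[OF lim[OF that]] _ False])
    show "\<forall>\<^sub>F y in F. norm (f k y) \<le> M k"
      using bound by eventually_elim (use that in blast)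
  qed
  then have "(\<lambda>k. norm (l k)) summable_on K"
    by (rule Infinite_Sum.abs_summable_on_comparison_test'[OF M])
  then have l: "(l has_sum (\<Sum>\<^sub>\<infinity>k\<in>K. l k)) K"
    by (rule has_sum_infsum[OF Infinite_Sum.abs_summable_summable])
  show ?thesis
  proof (rule swap_uniform_limit')
    show "\<forall>\<^sub>F X in finite_subsets_at_top K. ((\<lambda>y. \<Sum>k\<in>X. f k y) \<longlongrightarrow> (\<Sum>k\<in>X. l k)) F"
      using lim by (intro eventually_finite_subsets_at_top_weakI tendsto_sum) auto
    show "((\<lambda>X. \<Sum>k\<in>X. l k) \<longlongrightarrow> (\<Sum>\<^sub>\<infinity>k\<in>K. l k)) (finite_subsets_at_top K)"
      using l by (simp add: has_sum_def)
    show "uniform_limit {y. \<forall>k\<in>K. norm (f k y) \<le> M k} (\<lambda>X y. \<Sum>k\<in>X. f k y)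
            (\<lambda>y. \<Sum>\<^sub>\<infinity>k\<in>K. f k y) (finite_subsets_at_top K)"
      by (rule Weierstrass_m_test_general[OF _ M]) auto
  qed (use bound in auto)
qed auto

lemma infsum_bounded_multiples:
  fixes b m :: "'a \<Rightarrow> complex"
  assumes "(\<lambda>k. cmod (b k)) summable_on K" "\<And>k. k \<in> K \<Longrightarrow> cmod (m k) \<le> C"
  shows "(\<lambda>k. b k * m k) summable_on K"
    and "cmod (\<Sum>\<^sub>\<infinity>k\<in>K. b k * m k) \<le> (\<Sum>\<^sub>\<infinity>k\<in>K. cmod (b k)) * C"
proof -
  have bd: "cmod (b k * m k) \<le> cmod (b k) * C" if "k \<in> K" for k
    using assms(2)[OF that] by (auto simp: norm_mult intro: mult_left_mono)
  have s: "(\<lambda>k. cmod (b k) * C) summable_on K"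
    by (rule summable_on_cmult_left[OF assms(1)])
  show 1: "(\<lambda>k. b k * m k) summable_on K"
    by (rule abs_summable_summable[OF Infinite_Sum.abs_summable_on_comparison_test'[OF s bd]])
  have "((\<lambda>k. cmod (b k) * C) has_sum (\<Sum>\<^sub>\<infinity>k\<in>K. cmod (b k)) * C) K"
    by (intro has_sum_cmult_left has_sum_infsum assms(1))
  then show "cmod (\<Sum>\<^sub>\<infinity>k\<in>K. b k * m k) \<le> (\<Sum>\<^sub>\<infinity>k\<in>K. cmod (b k)) * C"
    by (rule norm_infsum_le[OF has_sum_infsum[OF 1] _ bd])
qed

section \<open>Trigonometric integrals over the unit interval\<close>

definition trig_integral :: "(real \<Rightarrow> complex) \<Rightarrow> real \<Rightarrow> complex" where
  "trig_integral p x = integral {-1..1} (\<lambda>s. p s * cis (x * s))"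

lemma has_vector_derivative_trig_integral:
  assumes p: "continuous_on {-1..1} p"
  shows "(trig_integral p has_vector_derivative trig_integral (\<lambda>s. \<i> * of_real s * p s) x) (at x)"
proof -
  have "((\<lambda>x. integral (cbox (-1) 1) (\<lambda>s. p s * cis (x * s))) has_vector_derivative
          integral (cbox (-1) 1) (\<lambda>s. \<i> * of_real s * p s * cis (x * s))) (at x within UNIV)"
  proof (rule leibniz_rule_vector_derivative)
    fix x s :: real
    have "((\<lambda>x. cis (x * s)) has_vector_derivative of_real s * (\<i> * cis (x * s))) (at x)"
      unfolding has_vector_derivative_def
      by (auto intro!: derivative_eq_intros simp: scaleR_conv_of_real)
    then show "((\<lambda>x. p s * cis (x * s)) has_vector_derivative \<i> * of_real s * p s * cis (x * s)) (at x)"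
      by (auto dest: has_vector_derivative_mult_right[of _ _ _ "p s"] simp: mult_ac)
  next
    show "(\<lambda>s. p s * cis (x * s)) integrable_on cbox (-1) 1" for x
      using p by (intro integrable_continuous continuous_intros) auto
    show "continuous_on (UNIV \<times> cbox (-1) 1) (\<lambda>(x, s). \<i> * of_real s * p s * cis (x * s))"
      unfolding split_beta
      by (intro continuous_intros continuous_on_compose2[OF p]) auto
  qed auto
  then show ?thesis
    by (simp add: trig_integral_def[abs_def])
qed

lemma continuous_on_trig_series:
  assumes "(\<lambda>k. cmod (a k)) summable_on K"
  shows "continuous_on S (\<lambda>s. \<Sum>\<^sub>\<infinity>k\<in>K. a k * cis (c k * s))"
proof (rule uniform_limit_theorem)
  show "\<forall>\<^sub>F X in finite_subsets_at_top K. continuous_on S (\<lambda>s. \<Sum>k\<in>X. a k * cis (c k * s))"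
    by (intro always_eventually allI continuous_intros)
  show "uniform_limit S (\<lambda>X s. \<Sum>k\<in>X. a k * cis (c k * s))
          (\<lambda>s. \<Sum>\<^sub>\<infinity>k\<in>K. a k * cis (c k * s)) (finite_subsets_at_top K)"
    by (rule Weierstrass_m_test_general[OF _ assms]) (simp add: norm_mult)
qed simp

text \<open>Modulating \<open>p\<close> by \<open>cis (c * s)\<close> translates its transform by \<open>c\<close>; absolute summability makes the
  modulated series converge uniformly, so the integral can be taken term by term. This turns the
  series of a quasiperiodic function into a series of translated transforms.\<close>

lemma has_sum_trig_integral_series:
  assumes p: "continuous_on {-1..1} p" and a: "(\<lambda>k. cmod (a k)) summable_on K"
  shows "((\<lambda>k. a k * trig_integral p (c k + x)) has_sum
           trig_integral (\<lambda>s. (\<Sum>\<^sub>\<infinity>k\<in>K. a k * cis (c k * s)) * p s) x) K"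
proof -
  let ?q = "\<lambda>s. p s * cis (x * s)"
  let ?g = "\<lambda>s. \<Sum>\<^sub>\<infinity>k\<in>K. a k * cis (c k * s)"
  have q: "continuous_on {-1..1} ?q"
    using p by (intro continuous_intros)
  have "uniform_limit {-1..1} (\<lambda>X s. (\<Sum>k\<in>X. a k * cis (c k * s)) * ?q s) (\<lambda>s. ?g s * ?q s)
          (finite_subsets_at_top K)"
  proof (rule uniform_lim_mult)
    show "uniform_limit {-1..1} (\<lambda>X s. \<Sum>k\<in>X. a k * cis (c k * s)) ?g (finite_subsets_at_top K)"
      by (rule Weierstrass_m_test_general[OF _ a]) (simp add: norm_mult)
    show "bounded (?g ` {-1..1})"
      by (intro compact_imp_bounded compact_continuous_image continuous_on_trig_series a) simp
    show "bounded (?q ` {-1..1})"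
      by (intro compact_imp_bounded compact_continuous_image q) simp
  qed (rule uniform_limit_const)
  moreover have "continuous_on {-1..1} (\<lambda>s. (\<Sum>k\<in>X. a k * cis (c k * s)) * ?q s)" for X
    using p by (intro continuous_intros)
  ultimately obtain I J
    where I: "\<And>X. ((\<lambda>s. (\<Sum>k\<in>X. a k * cis (c k * s)) * ?q s) has_integral I X) {-1..1}"
      and J: "((\<lambda>s. ?g s * ?q s) has_integral J) {-1..1}"
      and IJ: "(I \<longlongrightarrow> J) (finite_subsets_at_top K)"
    by (rule uniform_limit_integral[OF _ _ finite_subsets_at_top_neq_bot]) blast
  have "I X = (\<Sum>k\<in>X. a k * trig_integral p (c k + x))" if "finite X" for X
  proof (rule has_integral_unique[OF I])
    have "((\<lambda>s. p s * cis ((c k + x) * s)) has_integral trig_integral p (c k + x)) {-1..1}" for k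
      unfolding trig_integral_def
      using p by (intro integrable_integral integrable_continuous_real continuous_intros)
    then have "((\<lambda>s. \<Sum>k\<in>X. a k * (p s * cis ((c k + x) * s))) has_integral
            (\<Sum>k\<in>X. a k * trig_integral p (c k + x))) {-1..1}"
      using that by (intro has_integral_sum has_integral_mult_right)
    moreover have "(\<Sum>k\<in>X. a k * (p s * cis ((c k + x) * s))) = (\<Sum>k\<in>X. a k * cis (c k * s)) * ?q s" for s
      unfolding sum_distrib_right
      by (intro sum.cong refl) (simp only: distrib_right cis_mult[symmetric] mult.assoc mult.left_commute)
    ultimately show "((\<lambda>s. (\<Sum>k\<in>X. a k * cis (c k * s)) * ?q s) has_integral
            (\<Sum>k\<in>X. a k * trig_integral p (c k + x))) {-1..1}"
      by simp
  qed
  then have "((\<lambda>X. \<Sum>k\<in>X. a k * trig_integral p (c k + x)) \<longlongrightarrow> J) (finite_subsets_at_top K)"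
    by (intro Lim_transform_eventually[OF IJ] eventually_finite_subsets_at_top_weakI)
  moreover have "J = trig_integral (\<lambda>s. ?g s * p s) x"
    using J by (simp add: trig_integral_def mult.assoc integral_unique)
  ultimately show ?thesis
    by (simp add: has_sum_def)
qed

text \<open>When the transform of \<open>p\<close> is real valued, its derivative is again the transform of a continuous
  function and again real valued, so the lemma can be applied to its own conclusion. It is used
  twice, for the first and the second derivative of the transform of the weight.\<close>

lemma real_derivative_trig_integral:
  assumes p: "continuous_on {-1..1} p" and \<psi>: "\<And>x. trig_integral p x = of_real (\<psi> x)"
  shows "(\<psi> has_real_derivative deriv \<psi> x) (at x)"
    and "trig_integral (\<lambda>s. \<i> * of_real s * p s) x = of_real (deriv \<psi> x)"
proof -
  have \<psi>_eq: "\<psi> = (\<lambda>x. Re (trig_integral p x))"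
    by (simp add: \<psi>)
  have "((\<lambda>x. Re (trig_integral p x)) has_vector_derivative
           Re (trig_integral (\<lambda>s. \<i> * of_real s * p s) x)) (at x)"
    by (rule bounded_linear.has_vector_derivative[OF bounded_linear_Re
          has_vector_derivative_trig_integral[OF p]])
  then have "(\<psi> has_real_derivative Re (trig_integral (\<lambda>s. \<i> * of_real s * p s) x)) (at x)"
    unfolding \<psi>_eq by (simp add: has_real_derivative_iff_has_vector_derivative)
  then show der: "(\<psi> has_real_derivative deriv \<psi> x) (at x)"
    by (simp add: DERIV_imp_deriv)
  have "((\<lambda>x. complex_of_real (\<psi> x)) has_vector_derivative of_real (deriv \<psi> x)) (at x)"
    by (rule has_vector_derivative_of_real[OF der])
  moreover have "(\<lambda>x. of_real (\<psi> x)) = trig_integral p"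
    by (simp add: fun_eq_iff \<psi>)
  ultimately have "(trig_integral p has_vector_derivative of_real (deriv \<psi> x)) (at x)"
    by simp
  then show "trig_integral (\<lambda>s. \<i> * of_real s * p s) x = of_real (deriv \<psi> x)"
    by (rule vector_derivative_unique_at[OF has_vector_derivative_trig_integral[OF p]])
qed

section \<open>The transform of a weight function\<close>

locale weight =
  fixes w :: "real \<Rightarrow> real"
  assumes weight: "weight_function w"
begin

abbreviation \<phi> where "\<phi> \<equiv> weight_transform w"
abbreviation \<phi>' where "\<phi>' \<equiv> deriv \<phi>"
abbreviation \<phi>'' where "\<phi>'' \<equiv> deriv \<phi>'"
abbreviation kernel :: "real \<Rightarrow> complex" where "kernel \<equiv> \<lambda>s. of_real (w s) / 2"

lemma continuous_weight: "continuous_on {-1..1} w"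
proof -
  obtain D where D: "\<forall>t\<in>{-1..1}. D 0 t = w t"
    "\<forall>m. \<forall>t\<in>{-1..1}. (D m has_real_derivative D (Suc m) t) (at t within {-1..1})"
    using weight by (auto simp: weight_function_def smooth_within_def)
  have "continuous_on {-1..1} (D (0::nat))"
    using D(2) by (intro DERIV_continuous_on) blast
  then show ?thesis
    using D(1) by (subst (asm) continuous_on_cong[OF refl]) auto
qed

lemma weight_nonneg: "s \<in> {-1..1} \<Longrightarrow> 0 \<le> w s"
  using weight by (simp add: weight_function_def)

lemma has_integral_half_weight: "((\<lambda>s. w s / 2) has_integral 1) {-1..1}"
proof -
  have "(w has_integral integral {-1..1} w) {-1..1}"
    by (intro integrable_integral integrable_continuous_real continuous_weight)
  then have "((\<lambda>s. w s / 2) has_integral integral {-1..1} w / 2) {-1..1}"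
    by (rule has_integral_divide)
  then show ?thesis
    using weight by (simp add: weight_function_def)
qed

lemma continuous_kernel: "continuous_on {-1..1} kernel"
  by (intro continuous_intros continuous_weight) simp

lemma trig_integral_kernel: "trig_integral kernel x = of_real (\<phi> x)"
  unfolding of_real_weight_transform[OF weight] weighted_inner_def trig_integral_def
  by (simp add: integral_mult_right[symmetric] mult.commute del: integral_mult_right)

lemmas transform_derivative = real_derivative_trig_integral(1)[OF continuous_kernel trig_integral_kernel]
  and trig_integral_kernel_derivative = real_derivative_trig_integral(2)[OF continuous_kernel trig_integral_kernel]

lemma continuous_kernel_derivative: "continuous_on {-1..1} (\<lambda>s. \<i> * of_real s * kernel s)"
  by (intro continuous_intros continuous_weight) simp

lemmas transform_second_derivative =
    real_derivative_trig_integral(1)[OF continuous_kernel_derivative trig_integral_kernel_derivative]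
  and trig_integral_kernel_second_derivative =
    real_derivative_trig_integral(2)[OF continuous_kernel_derivative trig_integral_kernel_derivative]

lemma norm_trig_integral_le_1:
  assumes p: "continuous_on {-1..1} p" and le: "\<And>s. s \<in> {-1..1} \<Longrightarrow> cmod (p s) \<le> w s / 2"
  shows "cmod (trig_integral p x) \<le> 1"
proof -
  have "cmod (trig_integral p x) \<le> integral {-1..1} (\<lambda>s. w s / 2)"
    unfolding trig_integral_def
  proof (rule integral_norm_bound_integral)
    show "(\<lambda>s. p s * cis (x * s)) integrable_on {-1..1}"
      using p by (intro integrable_continuous_real continuous_intros)
    show "(\<lambda>s. w s / 2) integrable_on {-1..1}"
      using has_integral_half_weight by (rule has_integral_integrable)
  qed (use le in \<open>simp add: norm_mult\<close>)
  also have "\<dots> = 1"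
    by (rule integral_unique[OF has_integral_half_weight])
  finally show ?thesis .
qed

lemma abs_transform_le_1: "\<bar>\<phi> x\<bar> \<le> 1" "\<bar>\<phi>' x\<bar> \<le> 1" "\<bar>\<phi>'' x\<bar> \<le> 1"
proof -
  have "cmod (trig_integral kernel x) \<le> 1"
    using weight_nonneg by (intro norm_trig_integral_le_1 continuous_kernel) simp
  then show "\<bar>\<phi> x\<bar> \<le> 1"
    by (simp add: trig_integral_kernel)
  have le: "\<bar>s\<bar> * w s \<le> w s" if "s \<in> {-1..1}" for s
    using mult_right_mono[of "\<bar>s\<bar>" 1 "w s"] weight_nonneg[OF that] that by auto
  have "cmod (trig_integral (\<lambda>s. \<i> * of_real s * kernel s) x) \<le> 1"
    using weight_nonneg le
    by (intro norm_trig_integral_le_1 continuous_kernel_derivative) (simp add: norm_mult)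
  then show "\<bar>\<phi>' x\<bar> \<le> 1"
    by (simp only: trig_integral_kernel_derivative norm_of_real)
  have "cmod (trig_integral (\<lambda>s. \<i> * of_real s * (\<i> * of_real s * kernel s)) x) \<le> 1"
  proof (rule norm_trig_integral_le_1)
    show "continuous_on {-1..1} (\<lambda>s. \<i> * of_real s * (\<i> * of_real s * kernel s))"
      by (intro continuous_intros continuous_weight) simp
    fix s :: real assume s: "s \<in> {-1..1}"
    have "\<bar>s\<bar> * (\<bar>s\<bar> * w s) \<le> \<bar>s\<bar> * w s"
      by (rule mult_left_mono[OF le[OF s]]) simp
    then show "cmod (\<i> * of_real s * (\<i> * of_real s * kernel s)) \<le> w s / 2"
      using le[OF s] weight_nonneg[OF s] by (simp add: norm_mult)
  qed
  then show "\<bar>\<phi>'' x\<bar> \<le> 1"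
    by (simp only: trig_integral_kernel_second_derivative norm_of_real)
qed

lemma has_integral_Re_trig_integral:
  assumes "continuous_on {-1..1} p"
  shows "((\<lambda>s. Re (p s * cis (x * s))) has_integral Re (trig_integral p x)) {-1..1}"
proof -
  have "((\<lambda>s. p s * cis (x * s)) has_integral trig_integral p x) {-1..1}"
    unfolding trig_integral_def
    using assms by (intro integrable_integral integrable_continuous_real continuous_intros)
  from has_integral_linear[OF this bounded_linear_Re] show ?thesis
    by (simp add: o_def)
qed

lemma has_integral_transform: "((\<lambda>s. w s / 2 * cos (x * s)) has_integral \<phi> x) {-1..1}"
  using has_integral_Re_trig_integral[OF continuous_kernel, of x]
  by (simp add: trig_integral_kernel)

lemma transform_0: "\<phi> 0 = 1"
  using has_integral_transform[of 0] has_integral_half_weight by (simp add: has_integral_unique)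

lemma transform_derivative_0: "\<phi>' 0 = 0"
  using has_integral_Re_trig_integral[OF continuous_kernel_derivative, of 0]
  by (simp only: trig_integral_kernel_derivative) (simp add: has_integral_iff)

lemma has_integral_transform_second_derivative_0:
  "((\<lambda>s. - (s\<^sup>2 * (w s / 2))) has_integral \<phi>'' 0) {-1..1}"
proof -
  have "continuous_on {-1..1} (\<lambda>s. \<i> * of_real s * (\<i> * of_real s * kernel s))"
    by (intro continuous_intros continuous_weight) simp
  from has_integral_Re_trig_integral[OF this, of 0] show ?thesis
    by (simp only: trig_integral_kernel_second_derivative) (simp add: power2_eq_square mult.assoc)
qed

text \<open>Both signs \<open>\<epsilon>\<close> rest on
  \<open>1 - cos (2 \<theta>) = 2 (1 - \<epsilon> cos \<theta>) (1 + \<epsilon> cos \<theta>) \<le> 4 (1 - \<epsilon> cos \<theta>)\<close>, integrated against the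
  weight. If \<open>\<bar>\<phi>\<bar>\<close> is close to \<open>1\<close> at \<open>x\<close>, it is therefore close to \<open>1\<close> at \<open>2 x\<close> as well.\<close>

lemma transform_doubling: "1 - \<bar>\<phi> (2 * x)\<bar> \<le> 4 * (1 - \<bar>\<phi> x\<bar>)"
proof -
  have "1 - \<phi> (2 * x) \<le> 4 * (1 - \<epsilon> * \<phi> x)" if \<epsilon>: "\<epsilon> \<in> {-1, 1}" for \<epsilon> :: real
  proof (rule has_integral_le)
    show "((\<lambda>s. w s / 2 - w s / 2 * cos (2 * x * s)) has_integral 1 - \<phi> (2 * x)) {-1..1}"
      by (intro has_integral_diff has_integral_half_weight has_integral_transform)
    show "((\<lambda>s. 4 * (w s / 2 - \<epsilon> * (w s / 2 * cos (x * s)))) has_integral 4 * (1 - \<epsilon> * \<phi> x)) {-1..1}"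
      by (intro has_integral_mult_right has_integral_diff has_integral_half_weight has_integral_transform)
    fix s :: real assume s: "s \<in> {-1..1}"
    have "1 - cos (2 * x * s) = 2 * ((1 - \<epsilon> * cos (x * s)) * (1 + \<epsilon> * cos (x * s)))"
      using \<epsilon> cos_double_cos[of "x * s"] by (auto simp: algebra_simps power2_eq_square)
    also have "\<dots> \<le> 2 * ((1 - \<epsilon> * cos (x * s)) * 2)"
      using \<epsilon> by (intro mult_left_mono) (auto simp: minus_le_iff)
    finally have "w s / 2 * (1 - cos (2 * x * s)) \<le> w s / 2 * (4 * (1 - \<epsilon> * cos (x * s)))"
      using weight_nonneg[OF s] by (intro mult_left_mono) auto
    then show "w s / 2 - w s / 2 * cos (2 * x * s) \<le> 4 * (w s / 2 - \<epsilon> * (w s / 2 * cos (x * s)))"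
      by (simp add: algebra_simps)
  qed
  from this[of 1] this[of "-1"] show ?thesis
    by (auto simp: abs_if)
qed

text \<open>Boundedly many doublings carry every \<open>x\<close> with \<open>\<bar>x\<bar> \<ge> \<epsilon>\<close> into the region where \<open>\<bar>\<phi>\<bar> < 1 / 2\<close>,
  and each of them enlarges \<open>1 - \<bar>\<phi>\<bar>\<close> at most by the factor \<open>4\<close>. So the distance to \<open>1\<close> at \<open>x\<close> was
  not too small to begin with.\<close>

lemma transform_bounded_away_from_1:
  assumes decay: "(\<phi> \<longlongrightarrow> 0) at_infinity" and "\<epsilon> > 0"
  obtains c where "c > 0" "\<And>x. \<bar>x\<bar> \<ge> \<epsilon> \<Longrightarrow> \<bar>\<phi> x\<bar> \<le> 1 - c"
proof -
  have "\<forall>\<^sub>F x in at_infinity. \<bar>\<phi> x\<bar> < 1 / 2"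
    using tendstoD[OF decay, of "1 / 2"] by simp
  then obtain B where B: "\<And>x. B \<le> \<bar>x\<bar> \<Longrightarrow> \<bar>\<phi> x\<bar> < 1 / 2"
    by (auto simp: eventually_at_infinity)
  obtain m where "B / \<epsilon> < 2 ^ m"
    using real_arch_pow[of 2 "B / \<epsilon>"] by auto
  then have m: "B \<le> 2 ^ m * \<epsilon>"
    using \<open>\<epsilon> > 0\<close> by (simp add: field_simps)
  have iter: "1 - \<bar>\<phi> (2 ^ i * x)\<bar> \<le> 4 ^ i * (1 - \<bar>\<phi> x\<bar>)" for i x
  proof (induction i)
    case (Suc i)
    show ?case
      using transform_doubling[of "2 ^ i * x"] Suc by (simp add: mult.assoc)
  qed simp
  show ?thesis
  proof
    show "1 / (2 * 4 ^ m) > (0 :: real)"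
      by simp
    fix x assume x: "\<bar>x\<bar> \<ge> \<epsilon>"
    have "B \<le> \<bar>2 ^ m * x\<bar>"
      using order_trans[OF m mult_left_mono[OF x, of "2 ^ m"]] by (simp add: abs_mult)
    from B[OF this] iter[of m x] have "1 / 2 \<le> 4 ^ m * (1 - \<bar>\<phi> x\<bar>)"
      by linarith
    then show "\<bar>\<phi> x\<bar> \<le> 1 - 1 / (2 * 4 ^ m)"
      by (simp add: field_simps)
  qed
qed

text \<open>From \<open>1 - cos \<theta> \<le> \<theta>\<^sup>2 / 2\<close> one gets \<open>1 - \<phi> x \<le> - x\<^sup>2 \<phi>'' 0 / 2\<close>; if \<open>\<phi>'' 0\<close> were not
  negative, \<open>\<phi>\<close> would be at least \<open>1\<close> everywhere and could not decay.\<close>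

lemma transform_second_derivative_0_neg:
  assumes decay: "(\<phi> \<longlongrightarrow> 0) at_infinity"
  shows "\<phi>'' 0 < 0"
proof -
  have "1 - \<phi> x \<le> - (x\<^sup>2 / 2 * \<phi>'' 0)" for x
  proof (rule has_integral_le)
    show "((\<lambda>s. w s / 2 - w s / 2 * cos (x * s)) has_integral 1 - \<phi> x) {-1..1}"
      by (intro has_integral_diff has_integral_half_weight has_integral_transform)
    show "((\<lambda>s. - (x\<^sup>2 / 2 * (- (s\<^sup>2 * (w s / 2))))) has_integral - (x\<^sup>2 / 2 * \<phi>'' 0)) {-1..1}"
      by (intro has_integral_neg has_integral_mult_right has_integral_transform_second_derivative_0)
    fix s :: real assume s: "s \<in> {-1..1}"
    have "\<bar>sin (x * s / 2)\<bar> \<le> \<bar>x * s / 2\<bar>"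
      by (rule abs_sin_x_le_abs_x)
    then have "(sin (x * s / 2))\<^sup>2 \<le> (x * s / 2)\<^sup>2"
      by (rule abs_le_square_iff[THEN iffD1])
    then have "1 - cos (x * s) \<le> x\<^sup>2 / 2 * s\<^sup>2"
      using cos_double_sin[of "x * s / 2"] by (simp add: power_mult_distrib power_divide)
    then have "w s / 2 * (1 - cos (x * s)) \<le> w s / 2 * (x\<^sup>2 / 2 * s\<^sup>2)"
      using weight_nonneg[OF s] by (intro mult_left_mono) auto
    then show "w s / 2 - w s / 2 * cos (x * s) \<le> - (x\<^sup>2 / 2 * (- (s\<^sup>2 * (w s / 2))))"
      by (simp add: algebra_simps)
  qed
  moreover obtain c where c: "c > 0" "\<And>x. \<bar>x\<bar> \<ge> 1 \<Longrightarrow> \<bar>\<phi> x\<bar> \<le> 1 - c"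
    using transform_bounded_away_from_1[OF decay zero_less_one] by blast
  ultimately have "1 - \<phi> 1 \<le> - (\<phi>'' 0 / 2)"
    by (metis (no_types, lifting) mult.left_neutral one_power2 times_divide_eq_left)
  with c(1) c(2)[of 1] show ?thesis
    by (simp add: abs_le_iff)
qed

end

section \<open>Limits at infinity and expansions in inverse powers\<close>

text \<open>By the mean value inequality, since the whole segment from \<open>X t\<close> to \<open>X t + U t\<close> escapes to
  infinity. For \<open>U t = 0\<close> the quotient is \<open>0\<close> by convention, which is harmless because the quotient is going to be multiplied by \<open>U t\<close>.\<close>

lemma tendsto_difference_quotient_at_infinity:
  fixes \<psi> :: "real \<Rightarrow> real"
  assumes der: "\<And>x. (\<psi> has_real_derivative \<psi>' x) (at x)"
    and \<psi>': "(\<psi>' \<longlongrightarrow> 0) at_infinity"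
    and X: "filterlim X at_infinity F" and U: "(U \<longlongrightarrow> 0) F"
  shows "((\<lambda>t. (\<psi> (X t + U t) - \<psi> (X t)) / U t) \<longlongrightarrow> 0) F"
proof (rule tendstoI)
  fix e :: real assume "e > 0"
  then have "\<forall>\<^sub>F x in at_infinity. \<bar>\<psi>' x\<bar> < e / 2"
    using tendstoD[OF \<psi>', of "e / 2"] by simp
  then obtain B where B: "\<And>x. B \<le> \<bar>x\<bar> \<Longrightarrow> \<bar>\<psi>' x\<bar> < e / 2"
    by (auto simp: eventually_at_infinity)
  have "\<forall>\<^sub>F t in F. max B 0 + 1 \<le> norm (X t)"
    using X by (subst (asm) filterlim_at_infinity[of 0]) auto
  moreover have "\<forall>\<^sub>F t in F. \<bar>U t\<bar> < 1"
    using tendstoD[OF U, of 1] by simp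
  ultimately show "\<forall>\<^sub>F t in F. dist ((\<psi> (X t + U t) - \<psi> (X t)) / U t) 0 < e"
  proof eventually_elim
    case (elim t)
    have "norm (\<psi> (X t + U t) - \<psi> (X t)) \<le> e / 2 * norm (X t + U t - X t)"
    proof (rule field_differentiable_bound)
      fix z assume z: "z \<in> cball (X t) \<bar>U t\<bar>"
      then have "B \<le> \<bar>z\<bar>"
        using elim by (auto simp: dist_real_def)
      then show "norm (\<psi>' z) \<le> e / 2"
        using B[of z] by simp
      show "(\<psi> has_real_derivative \<psi>' z) (at z within cball (X t) \<bar>U t\<bar>)"
        by (rule has_field_derivative_at_within[OF der])
    qed (auto simp: dist_real_def)
    then have "\<bar>(\<psi> (X t + U t) - \<psi> (X t)) / U t\<bar> \<le> e / 2"
      using \<open>e > 0\<close> by (cases "U t = 0") (auto simp: divide_le_eq)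
    then show ?case
      using \<open>e > 0\<close> by (simp only: dist_real_def diff_0_right)
  qed
qed

lemma smallo_inverse_powerD:
  fixes f g :: "real \<Rightarrow> real"
  assumes "(\<lambda>x. f x - g x / x ^ n) \<in> o[at_infinity](\<lambda>x. 1 / x ^ n)"
  shows "((\<lambda>x. x ^ n * f x - g x) \<longlongrightarrow> 0) at_infinity"
proof (rule Lim_transform_eventually[OF smalloD_tendsto[OF assms]])
  show "\<forall>\<^sub>F x in at_infinity. (f x - g x / x ^ n) / (1 / x ^ n) = x ^ n * f x - g x"
    using eventually_not_equal_at_infinity[of 0] by eventually_elim (simp add: field_simps)
qed

lemma tendsto_0_if_inverse_power_expansion:
  fixes f g :: "real \<Rightarrow> real"
  assumes n: "n \<ge> 1" and g: "bounded (range g)"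
    and f: "(\<lambda>x. f x - g x / x ^ n) \<in> o[at_infinity](\<lambda>x. 1 / x ^ n)"
  shows "(f \<longlongrightarrow> 0) at_infinity"
proof -
  have "((\<lambda>x::real. inverse x ^ n) \<longlongrightarrow> 0 ^ n) at_infinity"
    by (intro tendsto_power tendsto_inverse_0)
  then have inv: "((\<lambda>x::real. inverse x ^ n) \<longlongrightarrow> 0) at_infinity"
    using n by (simp add: power_0_left)
  obtain G where "\<And>x. norm (g x) \<le> G"
    using g by (auto simp: bounded_iff)
  then have "((\<lambda>x. inverse x ^ n * g x) \<longlongrightarrow> 0) at_infinity"
    by (intro lim_null_mult_right_bounded[OF inv] always_eventually allI)
  with tendsto_mult[OF inv smallo_inverse_powerD[OF f]]
  have "((\<lambda>x. inverse x ^ n * (x ^ n * f x - g x) + inverse x ^ n * g x) \<longlongrightarrow> 0 * 0 + 0) at_infinity"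
    by (rule tendsto_add)
  then have "((\<lambda>x. inverse x ^ n * (x ^ n * f x - g x) + inverse x ^ n * g x) \<longlongrightarrow> 0) at_infinity"
    by simp
  then show ?thesis
  proof (rule Lim_transform_eventually)
    show "\<forall>\<^sub>F x in at_infinity. inverse x ^ n * (x ^ n * f x - g x) + inverse x ^ n * g x = f x"
      using eventually_not_equal_at_infinity[of 0]
      by eventually_elim (simp add: field_simps)
  qed
qed

text \<open>A bound on the whole line, not only near infinity: it serves as the dominating constant for all
  modes at once, including those for which \<open>\<Omega> k * T\<close> is still small.\<close>

lemma bounded_power_times_if_inverse_power_expansion:
  fixes f g :: "real \<Rightarrow> real"
  assumes g: "bounded (range g)" and f1: "\<And>x. \<bar>f x\<bar> \<le> 1"
    and f: "(\<lambda>x. f x - g x / x ^ n) \<in> o[at_infinity](\<lambda>x. 1 / x ^ n)"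
  obtains C where "\<And>x. \<bar>x ^ n * f x\<bar> \<le> C"
proof -
  obtain G where G: "\<And>x. \<bar>g x\<bar> \<le> G"
    using g by (auto simp: bounded_iff)
  have "\<forall>\<^sub>F x in at_infinity. \<bar>x ^ n * f x - g x\<bar> < 1"
    using tendstoD[OF smallo_inverse_powerD[OF f], of 1] by simp
  then obtain B where B: "\<And>x. B \<le> \<bar>x\<bar> \<Longrightarrow> \<bar>x ^ n * f x - g x\<bar> < 1"
    by (auto simp: eventually_at_infinity)
  have "\<bar>x ^ n * f x\<bar> \<le> max (\<bar>B\<bar> ^ n) (G + 1)" for x
  proof (cases "B \<le> \<bar>x\<bar>")
    case True
    show ?thesis
      using B[OF True] G[of x] by linarith
  next
    case False
    then have "\<bar>x\<bar> ^ n \<le> \<bar>B\<bar> ^ n"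
      by (intro power_mono) auto
    then have "\<bar>x\<bar> ^ n * \<bar>f x\<bar> \<le> \<bar>B\<bar> ^ n * 1"
      using f1[of x] by (intro mult_mono) auto
    then show ?thesis
      by (simp add: abs_mult power_abs)
  qed
  then show ?thesis ..
qed

text \<open>Convergence of \<open>m k\<close> is required only where \<open>b k\<close> does not vanish: a mode with zero coefficient
  may have zero detuning, and then \<open>\<Omega> k * T\<close> does not leave the peak.\<close>

lemma tendsto_0_infsum_bounded_multiples:
  fixes b :: "'k \<Rightarrow> complex" and m :: "'k \<Rightarrow> 'b \<Rightarrow> real"
  assumes b: "(\<lambda>k. cmod (b k)) summable_on K"
    and bound: "\<forall>\<^sub>F T in F. \<forall>k\<in>K. \<bar>m k T\<bar> \<le> C"
    and lim: "\<And>k. k \<in> K \<Longrightarrow> b k \<noteq> 0 \<Longrightarrow> (m k \<longlongrightarrow> 0) F"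
  shows "((\<lambda>T. \<Sum>\<^sub>\<infinity>k\<in>K. b k * of_real (m k T)) \<longlongrightarrow> 0) F"
proof -
  have "((\<lambda>T. \<Sum>\<^sub>\<infinity>k\<in>K. b k * of_real (m k T)) \<longlongrightarrow> (\<Sum>\<^sub>\<infinity>k\<in>K. 0)) F"
  proof (rule infsum_dominated_convergence)
    fix k assume "k \<in> K"
    then show "((\<lambda>T. b k * of_real (m k T)) \<longlongrightarrow> 0) F"
      using lim[of k]
      by (cases "b k = 0") (auto intro!: tendsto_mult_right_zero tendsto_of_real[where a = 0, simplified])
  next
    show "\<forall>\<^sub>F T in F. \<forall>k\<in>K. norm (b k * of_real (m k T)) \<le> cmod (b k) * C"
      using bound by eventually_elim (auto simp: norm_mult intro: mult_left_mono)
  qed (rule summable_on_cmult_left[OF b])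
  then show ?thesis
    by simp
qed

lemma filterlim_scaled_plus_bounded_at_infinity:
  fixes U :: "real \<Rightarrow> real"
  assumes "c \<noteq> 0" and U: "\<forall>\<^sub>F T in at_top. \<bar>U T\<bar> \<le> C"
  shows "filterlim (\<lambda>T. c * T + U T) at_infinity at_top"
proof (rule filterlim_norm_at_top_imp_at_infinity, rule filterlim_at_top_mono)
  show "filterlim (\<lambda>T. - C + \<bar>c\<bar> * T) at_top at_top"
    using \<open>c \<noteq> 0\<close>
    by (intro filterlim_tendsto_add_at_top[OF tendsto_const]
        filterlim_tendsto_pos_mult_at_top[OF tendsto_const] filterlim_ident) auto
  show "\<forall>\<^sub>F T in at_top. - C + \<bar>c\<bar> * T \<le> norm (c * T + U T)"
    using U eventually_ge_at_top[of 0]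
  proof eventually_elim
    case (elim T)
    then have "\<bar>c\<bar> * T = \<bar>c * T\<bar>"
      by (simp add: abs_mult)
    with elim show ?case
      by (simp add: abs_le_iff) linarith
  qed
qed

section \<open>The peak of the fundamental mode perturbed by the other modes\<close>

locale detuned_modes = weight +
  fixes K :: "'k set" and a :: "'k \<Rightarrow> complex" and \<Omega> :: "'k \<Rightarrow> real"
  assumes detuned: "\<And>k. k \<in> K \<Longrightarrow> a k \<noteq> 0 \<Longrightarrow> \<Omega> k \<noteq> 0"
    and a_summable: "(\<lambda>k. cmod (a k)) summable_on K"
    and decay: "(\<phi> \<longlongrightarrow> 0) at_infinity" "(\<phi>' \<longlongrightarrow> 0) at_infinity" "(\<phi>'' \<longlongrightarrow> 0) at_infinity"
begin

definition modal_sum :: "(real \<Rightarrow> real) \<Rightarrow> real \<Rightarrow> real \<Rightarrow> complex" where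
  "modal_sum \<psi> T u = (\<Sum>\<^sub>\<infinity>k\<in>K. a k * of_real (\<psi> (\<Omega> k * T + u)))"

text \<open>The signal on \<open>[-T,T]\<close>, rescaled to \<open>[-1,1]\<close>, after removal of the carrier
  \<open>cis (\<nu>\<^sub>1 * T * s)\<close>.\<close>

definition envelope :: "real \<Rightarrow> real \<Rightarrow> complex" where
  "envelope T s = 1 + (\<Sum>\<^sub>\<infinity>k\<in>K. a k * cis (\<Omega> k * T * s))"

text \<open>The function \<open>G T\<close> of the introduction.\<close>

definition amplitude :: "real \<Rightarrow> real \<Rightarrow> complex" where
  "amplitude T u = of_real (\<phi> u) + modal_sum \<phi> T u"

lemma continuous_envelope: "continuous_on S (envelope T)"
  unfolding envelope_def by (intro continuous_intros continuous_on_trig_series a_summable)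

lemma trig_integral_envelope:
  assumes p: "continuous_on {-1..1} p" and \<psi>: "\<And>x. trig_integral p x = of_real (\<psi> x)"
  shows "trig_integral (\<lambda>s. envelope T s * p s) u = of_real (\<psi> u) + modal_sum \<psi> T u"
proof -
  let ?g = "\<lambda>s. \<Sum>\<^sub>\<infinity>k\<in>K. a k * cis (\<Omega> k * T * s)"
  have "trig_integral (\<lambda>s. envelope T s * p s) u =
      integral {-1..1} (\<lambda>s. p s * cis (u * s) + ?g s * p s * cis (u * s))"
    by (simp add: trig_integral_def envelope_def distrib_right)
  also have "\<dots> = trig_integral p u + trig_integral (\<lambda>s. ?g s * p s) u"
    unfolding trig_integral_def using p
    by (intro Henstock_Kurzweil_Integration.integral_add integrable_continuous_real
        continuous_intros continuous_on_trig_series a_summable)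
  also have "trig_integral (\<lambda>s. ?g s * p s) u = modal_sum \<psi> T u"
    unfolding modal_sum_def
    using has_sum_trig_integral_series[OF p a_summable, of "\<lambda>k. \<Omega> k * T" u]
    by (simp add: \<psi> infsumI)
  finally show ?thesis
    by (simp add: \<psi>)
qed

lemma amplitude_eq_trig_integral: "amplitude T u = trig_integral (\<lambda>s. envelope T s * kernel s) u"
  unfolding amplitude_def by (rule trig_integral_envelope[OF continuous_kernel trig_integral_kernel, symmetric])

text \<open>Differentiating under the integral that represents \<open>amplitude T\<close> and expanding the result back
  into modes differentiates the series term by term.\<close>

lemma amplitude_derivative:
  "(amplitude T has_vector_derivative of_real (\<phi>' u) + modal_sum \<phi>' T u) (at u)"
proof -
  have "(trig_integral (\<lambda>s. envelope T s * kernel s) has_vector_derivative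
      trig_integral (\<lambda>s. \<i> * of_real s * (envelope T s * kernel s)) u) (at u)"
    by (intro has_vector_derivative_trig_integral continuous_on_mult continuous_envelope continuous_kernel)
  moreover have "trig_integral (\<lambda>s. \<i> * of_real s * (envelope T s * kernel s)) u =
      of_real (\<phi>' u) + modal_sum \<phi>' T u"
    using trig_integral_envelope[OF continuous_kernel_derivative trig_integral_kernel_derivative, of T u]
    by (simp add: mult_ac)
  moreover have "amplitude T = trig_integral (\<lambda>s. envelope T s * kernel s)"
    by (rule ext) (rule amplitude_eq_trig_integral)
  ultimately show ?thesis
    by simp
qed

lemma tendsto_modal_sum:
  assumes U: "\<forall>\<^sub>F T in at_top. \<bar>U T\<bar> \<le> C" and \<psi>1: "\<And>x. \<bar>\<psi> x\<bar> \<le> 1" and \<psi>: "(\<psi> \<longlongrightarrow> 0) at_infinity"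
  shows "((\<lambda>T. modal_sum \<psi> T (U T)) \<longlongrightarrow> 0) at_top"
  unfolding modal_sum_def
proof (rule tendsto_0_infsum_bounded_multiples[OF a_summable])
  show "\<forall>\<^sub>F T in at_top. \<forall>k\<in>K. \<bar>\<psi> (\<Omega> k * T + U T)\<bar> \<le> 1"
    by (simp add: \<psi>1)
  fix k assume "k \<in> K" "a k \<noteq> 0"
  from filterlim_scaled_plus_bounded_at_infinity[OF detuned[OF this] U]
  show "((\<lambda>T. \<psi> (\<Omega> k * T + U T)) \<longlongrightarrow> 0) at_top"
    by (rule filterlim_compose[OF \<psi>])
qed

lemma summable_modal_sum:
  assumes "\<And>x. \<bar>\<psi> x\<bar> \<le> 1"
  shows "(\<lambda>k. a k * of_real (\<psi> (\<Omega> k * T + u))) summable_on K"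
  by (rule infsum_bounded_multiples(1)[OF a_summable, of _ 1]) (simp add: assms)

text \<open>The total weight of the modes whose peak may lie in, or close to, a search interval of half-width
  comparable to \<open>r\<close>.\<close>

definition near_mass :: "real \<Rightarrow> real" where
  "near_mass r = (\<Sum>\<^sub>\<infinity>k\<in>K. if \<bar>\<Omega> k\<bar> \<le> r then cmod (a k) else 0)"

lemma near_mass_tendsto_0: "(near_mass \<longlongrightarrow> 0) (at_right 0)"
proof -
  have "(near_mass \<longlongrightarrow> (\<Sum>\<^sub>\<infinity>k\<in>K. 0)) (at_right 0)"
    unfolding near_mass_def[abs_def]
  proof (rule infsum_dominated_convergence[OF _ _ a_summable])
    fix k assume k: "k \<in> K"
    have "\<forall>\<^sub>F r in at_right 0. (if \<bar>\<Omega> k\<bar> \<le> r then cmod (a k) else 0) = 0"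
    proof (cases "a k = 0")
      case False
      then have "0 < \<bar>\<Omega> k\<bar>"
        using detuned[OF k] by simp
      then have "\<forall>\<^sub>F r in at_right 0. r < \<bar>\<Omega> k\<bar>"
        unfolding eventually_at_right_field by blast
      then show ?thesis
        by eventually_elim simp
    qed simp
    then show "((\<lambda>r. if \<bar>\<Omega> k\<bar> \<le> r then cmod (a k) else 0) \<longlongrightarrow> 0) (at_right 0)"
      by (rule tendsto_eventually)
  qed auto
  then show ?thesis
    by simp
qed

text \<open>For \<open>\<bar>\<Omega> k\<bar> > 2 \<delta>\<close> and \<open>\<bar>U T\<bar> \<le> \<delta> T\<close> the argument \<open>\<Omega> k * T + U T\<close> has modulus at least \<open>\<delta> T\<close>,
  so these modes fade out wherever the maximiser is; the remaining ones contribute at most \<open>1 / 4\<close>.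
  Comparison with \<open>u = 0\<close> then confines \<open>U\<close> to a bounded set, and in a bounded set every mode fades
  out, so that a second comparison forces \<open>\<bar>\<phi> (U T)\<bar> \<rightarrow> 1\<close>.\<close>

lemma maximizer_tendsto_0:
  assumes \<delta>: "\<delta> > 0" and near: "near_mass (2 * \<delta>) \<le> 1 / 4"
    and dom: "\<forall>\<^sub>F T in at_top. \<bar>U T\<bar> \<le> \<delta> * T"
    and max: "\<forall>\<^sub>F T in at_top. cmod (amplitude T 0) \<le> cmod (amplitude T (U T))"
  shows "(U \<longlongrightarrow> 0) at_top"
proof -
  define far where "far T = (\<Sum>\<^sub>\<infinity>k\<in>K. a k * of_real (if \<bar>\<Omega> k\<bar> \<le> 2 * \<delta> then 0 else \<phi> (\<Omega> k * T + U T)))" for T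
  have far: "(far \<longlongrightarrow> 0) at_top"
    unfolding far_def[abs_def]
  proof (rule tendsto_0_infsum_bounded_multiples[OF a_summable])
    show "\<forall>\<^sub>F T in at_top. \<forall>k\<in>K. \<bar>if \<bar>\<Omega> k\<bar> \<le> 2 * \<delta> then 0 else \<phi> (\<Omega> k * T + U T)\<bar> \<le> 1"
      by (simp add: abs_transform_le_1)
    fix k assume "k \<in> K" "a k \<noteq> 0"
    show "((\<lambda>T. if \<bar>\<Omega> k\<bar> \<le> 2 * \<delta> then 0 else \<phi> (\<Omega> k * T + U T)) \<longlongrightarrow> 0) at_top"
    proof (cases "\<bar>\<Omega> k\<bar> \<le> 2 * \<delta>")
      case False
      have "filterlim (\<lambda>T. \<Omega> k * T + U T) at_infinity at_top"
      proof (rule filterlim_norm_at_top_imp_at_infinity, rule filterlim_at_top_mono)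
        show "filterlim (\<lambda>T. \<delta> * T) at_top at_top"
          using \<delta> by (intro filterlim_tendsto_pos_mult_at_top[OF tendsto_const] filterlim_ident)
        show "\<forall>\<^sub>F T in at_top. \<delta> * T \<le> norm (\<Omega> k * T + U T)"
          using dom eventually_ge_at_top[of 0]
        proof eventually_elim
          case (elim T)
          have "2 * \<delta> * T \<le> \<bar>\<Omega> k\<bar> * T"
            using False elim by (intro mult_right_mono) auto
          also have "\<dots> = \<bar>\<Omega> k * T\<bar>"
            using elim by (simp add: abs_mult)
          finally show ?case
            using elim(1) by (simp only: real_norm_def)
        qed
      qed
      from filterlim_compose[OF decay(1) this] False show ?thesis
        by simp
    qed simp
  qed
  have split: "cmod (modal_sum \<phi> T (U T)) \<le> 1 / 4 + cmod (far T)" for T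
  proof -
    define b where "b k = (if \<bar>\<Omega> k\<bar> \<le> 2 * \<delta> then a k else 0)" for k
    have b_norm: "(\<lambda>k. cmod (b k)) = (\<lambda>k. if \<bar>\<Omega> k\<bar> \<le> 2 * \<delta> then cmod (a k) else 0)"
      by (auto simp: b_def)
    have b: "(\<lambda>k. cmod (b k)) summable_on K"
      by (rule summable_on_comparison_test[OF a_summable]) (auto simp: b_def)
    note near_part = infsum_bounded_multiples[OF b, of "\<lambda>k. of_real (\<phi> (\<Omega> k * T + U T))" 1]
    have sum: "modal_sum \<phi> T (U T) = (\<Sum>\<^sub>\<infinity>k\<in>K. b k * of_real (\<phi> (\<Omega> k * T + U T))) + far T"
      unfolding far_def modal_sum_def
    proof (subst infsum_add[symmetric])
      show "(\<lambda>k. b k * of_real (\<phi> (\<Omega> k * T + U T))) summable_on K"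
        by (rule near_part(1)) (simp add: abs_transform_le_1)
      show "(\<lambda>k. a k * of_real (if \<bar>\<Omega> k\<bar> \<le> 2 * \<delta> then 0 else \<phi> (\<Omega> k * T + U T))) summable_on K"
        by (rule infsum_bounded_multiples(1)[OF a_summable, of _ 1]) (simp add: abs_transform_le_1)
    qed (auto intro!: infsum_cong simp: b_def)
    have "cmod (\<Sum>\<^sub>\<infinity>k\<in>K. b k * of_real (\<phi> (\<Omega> k * T + U T))) \<le> 1 / 4"
      using near_part(2) near by (simp add: abs_transform_le_1 b_norm near_mass_def)
    then show ?thesis
      unfolding sum by (intro norm_triangle_mono order_refl)
  qed
  have at_0: "((\<lambda>T. modal_sum \<phi> T 0) \<longlongrightarrow> 0) at_top"
    by (rule tendsto_modal_sum[where C = 0]) (auto simp: abs_transform_le_1 decay)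
  \<comment> \<open>the comparison with \<open>u = 0\<close>, used below with two different estimates of \<open>modal_sum \<phi> T (U T)\<close>\<close>
  have lower: "\<forall>\<^sub>F T in at_top. 1 - cmod (modal_sum \<phi> T 0) - cmod (modal_sum \<phi> T (U T)) \<le> \<bar>\<phi> (U T)\<bar>"
    using max
  proof eventually_elim
    case (elim T)
    have "1 - cmod (modal_sum \<phi> T 0) \<le> cmod (amplitude T 0)"
      using norm_diff_ineq[of 1 "modal_sum \<phi> T 0"] by (simp add: amplitude_def transform_0)
    moreover have "cmod (amplitude T (U T)) \<le> \<bar>\<phi> (U T)\<bar> + cmod (modal_sum \<phi> T (U T))"
      unfolding amplitude_def by (rule order_trans[OF norm_triangle_ineq]) simp
    ultimately show ?case
      using elim by linarith
  qed
  have "\<forall>\<^sub>F x in at_infinity. \<bar>\<phi> x\<bar> < 1 / 2"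
    using tendstoD[OF decay(1), of "1 / 2"] by simp
  then obtain B where B: "\<And>x. B \<le> \<bar>x\<bar> \<Longrightarrow> \<bar>\<phi> x\<bar> < 1 / 2"
    by (auto simp: eventually_at_infinity)
  \<comment> \<open>\<open>1 - 1 / 8 - (1 / 4 + 1 / 8) = 1 / 2\<close>\<close>
  have "\<forall>\<^sub>F T in at_top. \<bar>U T\<bar> \<le> B"
    using lower tendstoD[OF far, of "1 / 8", simplified] tendstoD[OF at_0, of "1 / 8", simplified]
  proof eventually_elim
    case (elim T)
    then have "1 / 2 \<le> \<bar>\<phi> (U T)\<bar>"
      using split[of T] by linarith
    then show ?case
      using B[of "U T"] by linarith
  qed
  then have at_U: "((\<lambda>T. modal_sum \<phi> T (U T)) \<longlongrightarrow> 0) at_top"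
    by (rule tendsto_modal_sum) (auto simp: abs_transform_le_1 decay)
  show ?thesis
  proof (rule tendstoI)
    fix e :: real assume "e > 0"
    then obtain c where c: "c > 0" "\<And>x. \<bar>x\<bar> \<ge> e \<Longrightarrow> \<bar>\<phi> x\<bar> \<le> 1 - c"
      using transform_bounded_away_from_1[OF decay(1)] by blast
    show "\<forall>\<^sub>F T in at_top. dist (U T) 0 < e"
      using lower tendstoD[OF at_U half_gt_zero[OF c(1)]] tendstoD[OF at_0 half_gt_zero[OF c(1)]]
    proof eventually_elim
      case (elim T)
      then have "1 - c < \<bar>\<phi> (U T)\<bar>"
        by (simp only: dist_0_norm dist_commute[of _ 0])
      then show ?case
        using c(2)[of "U T"] by (simp only: dist_real_def diff_0_right real_norm_def) linarith
    qed
  qed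
qed

lemma critical_point_equation:
  assumes "d > 0" and max: "\<And>v. \<bar>u - v\<bar> < d \<Longrightarrow> cmod (amplitude T v) \<le> cmod (amplitude T u)"
  shows "Re (amplitude T u) * (\<phi>' u + Re (modal_sum \<phi>' T u)) + Im (amplitude T u) * Im (modal_sum \<phi>' T u) = 0"
proof -
  let ?A' = "of_real (\<phi>' u) + modal_sum \<phi>' T u"
  have Re: "((\<lambda>v. Re (amplitude T v)) has_real_derivative Re ?A') (at u)"
    and Im: "((\<lambda>v. Im (amplitude T v)) has_real_derivative Im ?A') (at u)"
    using bounded_linear.has_vector_derivative[OF bounded_linear_Re amplitude_derivative]
      bounded_linear.has_vector_derivative[OF bounded_linear_Im amplitude_derivative]
    by (simp_all add: has_real_derivative_iff_has_vector_derivative)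
  have "((\<lambda>v. (Re (amplitude T v))\<^sup>2 + (Im (amplitude T v))\<^sup>2) has_real_derivative
      2 * (Re (amplitude T u) * Re ?A' + Im (amplitude T u) * Im ?A')) (at u)"
    by (rule derivative_eq_intros Re Im refl)+ (simp add: algebra_simps)
  then have "2 * (Re (amplitude T u) * Re ?A' + Im (amplitude T u) * Im ?A') = 0"
  proof (rule DERIV_local_max[OF _ \<open>d > 0\<close>], intro allI impI)
    fix v assume "\<bar>u - v\<bar> < d"
    then have "(cmod (amplitude T v))\<^sup>2 \<le> (cmod (amplitude T u))\<^sup>2"
      by (intro power_mono max) auto
    then show "(Re (amplitude T v))\<^sup>2 + (Im (amplitude T v))\<^sup>2 \<le> (Re (amplitude T u))\<^sup>2 + (Im (amplitude T u))\<^sup>2"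
      by (simp only: cmod_power2)
  qed
  then show ?thesis
    by simp
qed

section \<open>Expansion of the maximiser\<close>

definition difference_sum :: "real \<Rightarrow> real \<Rightarrow> complex" where
  "difference_sum T u = (\<Sum>\<^sub>\<infinity>k\<in>K. a k * of_real ((\<phi>' (\<Omega> k * T + u) - \<phi>' (\<Omega> k * T)) / u))"

lemma transform_derivative_difference_quotient_le_1: "\<bar>(\<phi>' (x + u) - \<phi>' x) / u\<bar> \<le> 1"
proof -
  have "norm (\<phi>' (x + u) - \<phi>' x) \<le> 1 * norm (x + u - x)"
    by (rule field_differentiable_bound[of UNIV])
      (auto simp: abs_transform_le_1 intro: transform_second_derivative)
  then show ?thesis
    by (cases "u = 0") (auto simp: divide_le_eq)
qed

text \<open>The difference quotients separate a factor \<open>u\<close>, so that in the critical point equation the change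
  of \<open>modal_sum \<phi>'\<close> between \<open>0\<close> and \<open>u\<close> only perturbs the coefficient \<open>\<phi>'' 0\<close> of \<open>u\<close>.\<close>

lemma modal_sum_difference: "modal_sum \<phi>' T u = modal_sum \<phi>' T 0 + of_real u * difference_sum T u"
proof -
  have "(\<lambda>k. a k * of_real ((\<phi>' (\<Omega> k * T + u) - \<phi>' (\<Omega> k * T)) / u)) summable_on K"
    by (rule infsum_bounded_multiples(1)[OF a_summable, of _ 1])
      (use transform_derivative_difference_quotient_le_1 in \<open>simp only: norm_of_real\<close>)
  then have s: "((\<lambda>k. of_real u * (a k * of_real ((\<phi>' (\<Omega> k * T + u) - \<phi>' (\<Omega> k * T)) / u))) has_sum
      of_real u * difference_sum T u) K"
    unfolding difference_sum_def by (intro has_sum_cmult_right has_sum_infsum)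
  have s0: "((\<lambda>k. a k * of_real (\<phi>' (\<Omega> k * T + 0))) has_sum modal_sum \<phi>' T 0) K"
    unfolding modal_sum_def by (intro has_sum_infsum summable_modal_sum abs_transform_le_1)
  have "((\<lambda>k. a k * of_real (\<phi>' (\<Omega> k * T + u))) has_sum
      modal_sum \<phi>' T 0 + of_real u * difference_sum T u) K"
    using has_sum_add[OF s0 s]
    by (rule has_sum_cong[THEN iffD1, rotated]) (cases "u = 0"; simp add: field_simps)
  then show ?thesis
    unfolding modal_sum_def[of _ _ u] by (rule infsumI)
qed

lemma difference_sum_tendsto_0:
  assumes U: "(U \<longlongrightarrow> 0) at_top"
  shows "((\<lambda>T. difference_sum T (U T)) \<longlongrightarrow> 0) at_top"
  unfolding difference_sum_def
proof (rule tendsto_0_infsum_bounded_multiples[OF a_summable])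
  show "\<forall>\<^sub>F T in at_top. \<forall>k\<in>K. \<bar>(\<phi>' (\<Omega> k * T + U T) - \<phi>' (\<Omega> k * T)) / U T\<bar> \<le> 1"
    by (intro always_eventually allI ballI transform_derivative_difference_quotient_le_1)
  fix k assume "k \<in> K" "a k \<noteq> 0"
  then have "filterlim (\<lambda>T. \<Omega> k * T) at_infinity at_top"
    using filterlim_scaled_plus_bounded_at_infinity[of "\<Omega> k" "\<lambda>_. 0" 0] detuned by simp
  then show "((\<lambda>T. (\<phi>' (\<Omega> k * T + U T) - \<phi>' (\<Omega> k * T)) / U T) \<longlongrightarrow> 0) at_top"
    by (rule tendsto_difference_quotient_at_infinity[OF transform_second_derivative decay(3) _ U])
qed

definition leading_sum :: "nat \<Rightarrow> (real \<Rightarrow> real) \<Rightarrow> real \<Rightarrow> real" where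
  "leading_sum n g T = (\<Sum>\<^sub>\<infinity>k\<in>K. Re (a k) / \<Omega> k ^ n * g (\<Omega> k * T))"

text \<open>The factor \<open>T ^ n\<close> is absorbed as \<open>(\<Omega> k * T) ^ n / \<Omega> k ^ n\<close>. What remains is
  \<open>x ^ n * \<phi>' x\<close> at \<open>x = \<Omega> k * T\<close>, a bounded function of \<open>x\<close> that differs from \<open>g x\<close> by \<open>o(1)\<close>,
  and coefficients \<open>a k / \<Omega> k ^ n\<close> that are absolutely summable by assumption.\<close>

lemma modal_sum_leading_term:
  assumes b: "(\<lambda>k. cmod (a k / of_real (\<Omega> k ^ n))) summable_on K"
    and g: "bounded (range g)"
    and expansion: "(\<lambda>x. \<phi>' x - g x / x ^ n) \<in> o[at_infinity](\<lambda>x. 1 / x ^ n)"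
  obtains C where "\<And>T. cmod (of_real (T ^ n) * modal_sum \<phi>' T 0) \<le> C"
    and "((\<lambda>T. leading_sum n g T - Re (of_real (T ^ n) * modal_sum \<phi>' T 0)) \<longlongrightarrow> 0) at_top"
proof -
  define b where "b k = a k / of_real (\<Omega> k ^ n)" for k
  have b_summable: "(\<lambda>k. cmod (b k)) summable_on K"
    unfolding b_def by (rule assms(1))
  obtain C where C: "\<And>x. \<bar>x ^ n * \<phi>' x\<bar> \<le> C"
    using bounded_power_times_if_inverse_power_expansion[OF g abs_transform_le_1(2) expansion] by blast
  obtain G where G: "\<And>x. \<bar>g x\<bar> \<le> G"
    using g by (auto simp: bounded_iff)
  let ?p = "\<lambda>x. x ^ n * \<phi>' x"
  have "((\<lambda>k. a k * of_real (\<phi>' (\<Omega> k * T + 0))) has_sum modal_sum \<phi>' T 0) K" for T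
    unfolding modal_sum_def by (intro has_sum_infsum summable_modal_sum abs_transform_le_1)
  from has_sum_cmult_right[OF this, of "of_real (T ^ n)" for T]
  have P: "((\<lambda>k. b k * of_real (?p (\<Omega> k * T))) has_sum of_real (T ^ n) * modal_sum \<phi>' T 0) K" for T
  proof (rule has_sum_cong[THEN iffD1, rotated])
    fix k assume "k \<in> K"
    then show "of_real (T ^ n) * (a k * of_real (\<phi>' (\<Omega> k * T + 0))) = b k * of_real (?p (\<Omega> k * T))"
      using detuned[of k] by (cases "a k = 0") (simp_all add: b_def power_mult_distrib)
  qed
  have V: "((\<lambda>k. b k * of_real (g (\<Omega> k * T))) has_sum (\<Sum>\<^sub>\<infinity>k\<in>K. b k * of_real (g (\<Omega> k * T)))) K" for T
    by (intro has_sum_infsum infsum_bounded_multiples(1)[OF b_summable, of _ G]) (simp add: G)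
  have leading: "leading_sum n g T = Re (\<Sum>\<^sub>\<infinity>k\<in>K. b k * of_real (g (\<Omega> k * T)))" for T
    using has_sum_Re[OF V, of T]
    by (simp add: leading_sum_def b_def infsumI flip: of_real_power)
  have diff: "((\<lambda>k. b k * of_real (g (\<Omega> k * T) - ?p (\<Omega> k * T))) has_sum
      (\<Sum>\<^sub>\<infinity>k\<in>K. b k * of_real (g (\<Omega> k * T))) - of_real (T ^ n) * modal_sum \<phi>' T 0) K" for T
    using has_sum_add[OF V[of T] has_sum_uminusI[OF P[of T]]] by (simp add: algebra_simps)
  show ?thesis
  proof
    show "cmod (of_real (T ^ n) * modal_sum \<phi>' T 0) \<le> (\<Sum>\<^sub>\<infinity>k\<in>K. cmod (b k)) * C" for T
      unfolding infsumI[OF P, symmetric]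
      by (rule infsum_bounded_multiples(2)[OF b_summable]) (simp only: norm_of_real C)
    have "((\<lambda>T. \<Sum>\<^sub>\<infinity>k\<in>K. b k * of_real (g (\<Omega> k * T) - ?p (\<Omega> k * T))) \<longlongrightarrow> 0) at_top"
    proof (rule tendsto_0_infsum_bounded_multiples[OF b_summable])
      show "\<forall>\<^sub>F T in at_top. \<forall>k\<in>K. \<bar>g (\<Omega> k * T) - ?p (\<Omega> k * T)\<bar> \<le> G + C"
        using G C by (intro always_eventually allI ballI order_trans[OF abs_triangle_ineq4] add_mono)
      fix k assume "k \<in> K" "b k \<noteq> 0"
      then have "filterlim (\<lambda>T. \<Omega> k * T) at_infinity at_top"
        using filterlim_scaled_plus_bounded_at_infinity[of "\<Omega> k" "\<lambda>_. 0" 0] detuned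
        by (auto simp: b_def)
      from tendsto_minus[OF filterlim_compose[OF smallo_inverse_powerD[OF expansion] this]]
      show "((\<lambda>T. g (\<Omega> k * T) - ?p (\<Omega> k * T)) \<longlongrightarrow> 0) at_top"
        by simp
    qed
    from tendsto_Re[OF this]
    show "((\<lambda>T. leading_sum n g T - Re (of_real (T ^ n) * modal_sum \<phi>' T 0)) \<longlongrightarrow> 0) at_top"
      by (simp only: infsumI[OF diff] leading minus_complex.sel zero_complex.sel)
  qed
qed

text \<open>With \<open>P = T ^ n * S T\<close>, where \<open>S T\<close> is \<open>modal_sum \<phi>' T 0\<close>, the critical point equation is linear in
  \<open>T ^ n * U T\<close>, namely \<open>T ^ n * U T * den = - (Re A * Re P + Im A * Im P)\<close>. Since \<open>P\<close> is bounded and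
  \<open>den \<rightarrow> \<phi>'' 0\<close>, \<open>Re A \<rightarrow> 1\<close>, \<open>Im A \<rightarrow> 0\<close>, it gives \<open>T ^ n * U T = - Re P / \<phi>'' 0 + o(1)\<close>.\<close>

lemma maximizer_expansion:
  assumes b: "(\<lambda>k. cmod (a k / of_real (\<Omega> k ^ n))) summable_on K"
    and g: "bounded (range g)"
    and expansion: "(\<lambda>x. \<phi>' x - g x / x ^ n) \<in> o[at_infinity](\<lambda>x. 1 / x ^ n)"
    and U: "(U \<longlongrightarrow> 0) at_top" and "\<delta> > 0"
    and max: "\<forall>\<^sub>F T in at_top. \<forall>v. \<bar>v\<bar> \<le> \<delta> * T \<longrightarrow> cmod (amplitude T v) \<le> cmod (amplitude T (U T))"
  shows "((\<lambda>T. T ^ n * U T + leading_sum n g T / \<phi>'' 0) \<longlongrightarrow> 0) at_top"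
proof -
  define c where "c = \<phi>'' 0"
  have c: "c \<noteq> 0"
    using transform_second_derivative_0_neg[OF decay(1)] by (simp add: c_def)
  obtain C where C: "\<And>T. cmod (of_real (T ^ n) * modal_sum \<phi>' T 0) \<le> C"
    and leading: "((\<lambda>T. leading_sum n g T - Re (of_real (T ^ n) * modal_sum \<phi>' T 0)) \<longlongrightarrow> 0) at_top"
    using modal_sum_leading_term[OF b g expansion] by blast
  define P where "P T = of_real (T ^ n) * modal_sum \<phi>' T 0" for T
  define A where "A T = amplitude T (U T)" for T
  define Q where "Q T = difference_sum T (U T)" for T
  \<comment> \<open>\<open>\<phi>' h / h\<close>, extended continuously to \<open>0\<close>: the maximiser may be exactly \<open>0\<close>\<close>
  define slope where "slope h = (if h = 0 then c else \<phi>' h / h)" for h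
  have slope_mult: "\<phi>' h = h * slope h" for h
    by (simp add: slope_def transform_derivative_0)
  have "((\<lambda>h. \<phi>' h / h) \<longlongrightarrow> c) (at 0)"
    using transform_second_derivative[of 0] by (simp add: DERIV_def transform_derivative_0 c_def)
  then have "(slope \<longlongrightarrow> c) (at 0)"
    by (rule Lim_transform_eventually) (auto simp: slope_def eventually_at_filter)
  then have "isCont slope 0"
    by (simp add: isCont_def slope_def)
  from isCont_tendsto_compose[OF this U] have slope: "((\<lambda>T. slope (U T)) \<longlongrightarrow> c) at_top"
    by (simp add: slope_def)
  have Q: "(Q \<longlongrightarrow> 0) at_top"
    unfolding Q_def[abs_def] by (rule difference_sum_tendsto_0[OF U])
  have U1: "\<forall>\<^sub>F T in at_top. \<bar>U T\<bar> \<le> 1"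
    using tendstoD[OF U, of 1] by (auto elim: eventually_mono)
  have "((\<lambda>T. \<phi> (U T)) \<longlongrightarrow> \<phi> 0) at_top"
    by (rule isCont_tendsto_compose[OF DERIV_isCont[OF transform_derivative] U])
  then have "(A \<longlongrightarrow> of_real (\<phi> 0) + 0) at_top"
    unfolding A_def[abs_def] amplitude_def
    by (intro tendsto_add tendsto_of_real tendsto_modal_sum[OF U1]) (auto simp: abs_transform_le_1 decay)
  then have A: "((\<lambda>T. Re (A T)) \<longlongrightarrow> 1) at_top" "((\<lambda>T. Im (A T)) \<longlongrightarrow> 0) at_top"
    by (auto dest: tendsto_Re tendsto_Im simp: transform_0)
  define den where "den T = Re (A T) * (slope (U T) + Re (Q T)) + Im (A T) * Im (Q T)" for T
  have "(den \<longlongrightarrow> 1 * (c + Re 0) + 0 * Im 0) at_top"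
    unfolding den_def[abs_def]
    by (intro tendsto_add tendsto_mult A slope tendsto_Re tendsto_Im Q)
  then have den: "(den \<longlongrightarrow> c) at_top"
    by simp
  \<comment> \<open>once \<open>\<bar>U T\<bar> < 1 < \<delta> * T\<close>, the maximum is attained in the interior\<close>
  have "\<forall>\<^sub>F T in at_top. 1 < \<delta> * T"
    using \<open>\<delta> > 0\<close> eventually_gt_at_top[of "1 / \<delta>"]
    by (auto elim!: eventually_mono simp: field_simps)
  then have critical: "\<forall>\<^sub>F T in at_top. U T * den T = - (Re (A T) * Re (modal_sum \<phi>' T 0) + Im (A T) * Im (modal_sum \<phi>' T 0))"
    using max tendstoD[OF U, of 1, simplified]
  proof eventually_elim
    case (elim T)
    have "Re (A T) * (\<phi>' (U T) + Re (modal_sum \<phi>' T (U T))) + Im (A T) * Im (modal_sum \<phi>' T (U T)) = 0"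
      unfolding A_def
    proof (rule critical_point_equation)
      show "\<delta> * T - \<bar>U T\<bar> > 0"
        using elim by linarith
      fix v assume "\<bar>U T - v\<bar> < \<delta> * T - \<bar>U T\<bar>"
      then have "\<bar>v\<bar> \<le> \<delta> * T"
        by linarith
      with elim show "cmod (amplitude T v) \<le> cmod (amplitude T (U T))"
        by blast
    qed
    then show ?case
      unfolding modal_sum_difference[of T "U T"] slope_mult[of "U T"] den_def Q_def
      by (simp add: algebra_simps)
  qed
  have "((\<lambda>T. Re (P T) * (1 / c - Re (A T) / den T)) \<longlongrightarrow> 0) at_top"
  proof (rule lim_null_mult_left_bounded)
    show "\<forall>\<^sub>F T in at_top. norm (Re (P T)) \<le> C"
      unfolding P_def real_norm_def
      by (intro always_eventually allI order_trans[OF abs_Re_le_cmod C])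
    have "((\<lambda>T. 1 / c - Re (A T) / den T) \<longlongrightarrow> 1 / c - 1 / c) at_top"
      by (intro tendsto_intros A den c)
    then show "((\<lambda>T. 1 / c - Re (A T) / den T) \<longlongrightarrow> 0) at_top"
      by simp
  qed
  moreover have "((\<lambda>T. Im (P T) * (Im (A T) / den T)) \<longlongrightarrow> 0) at_top"
  proof (rule lim_null_mult_left_bounded)
    show "\<forall>\<^sub>F T in at_top. norm (Im (P T)) \<le> C"
      unfolding P_def real_norm_def
      by (intro always_eventually allI order_trans[OF abs_Im_le_cmod C])
    have "((\<lambda>T. Im (A T) / den T) \<longlongrightarrow> 0 / c) at_top"
      by (intro tendsto_intros A den c)
    then show "((\<lambda>T. Im (A T) / den T) \<longlongrightarrow> 0) at_top"
      by simp
  qed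
  moreover have "((\<lambda>T. (leading_sum n g T - Re (P T)) / c) \<longlongrightarrow> 0) at_top"
    using tendsto_divide[OF leading tendsto_const c] by (simp only: P_def div_0)
  ultimately have "((\<lambda>T. Re (P T) * (1 / c - Re (A T) / den T) - Im (P T) * (Im (A T) / den T)
      + (leading_sum n g T - Re (P T)) / c) \<longlongrightarrow> 0 - 0 + 0) at_top"
    by (intro tendsto_add tendsto_diff)
  then show ?thesis
    unfolding c_def[symmetric] diff_0_right add_0
  proof (rule Lim_transform_eventually)
    show "\<forall>\<^sub>F T in at_top. Re (P T) * (1 / c - Re (A T) / den T) - Im (P T) * (Im (A T) / den T)
      + (leading_sum n g T - Re (P T)) / c = T ^ n * U T + leading_sum n g T / c"
      using critical tendsto_imp_eventually_ne[OF den c]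
    proof eventually_elim
      case (elim T)
      have "T ^ n * U T * den T = T ^ n * (U T * den T)"
        by simp
      also have "\<dots> = - (Re (A T) * Re (P T) + Im (A T) * Im (P T))"
        unfolding elim(1) P_def by (simp add: algebra_simps flip: of_real_power)
      finally have "T ^ n * U T = - (Re (A T) * Re (P T) + Im (A T) * Im (P T)) / den T"
        using elim(2) by (simp add: field_simps)
      then show ?case
        using c by (simp add: diff_divide_distrib add_divide_distrib algebra_simps)
    qed
  qed
qed

end

section \<open>From the frequency map to the perturbed peak\<close>

lemma weighted_inner_rescale:
  assumes T: "T > 0" and cont: "continuous_on {-1..1} (\<lambda>s. f (T * s) * cnj (h (T * s)) * of_real (w s))"
  shows "weighted_inner w T f h = integral {-1..1} (\<lambda>s. f (T * s) * cnj (h (T * s)) * of_real (w s) / 2)"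
proof -
  let ?F = "\<lambda>s. f (T * s) * cnj (h (T * s)) * of_real (w s)"
  have "(?F has_integral integral {-1..1} ?F) {-1..1}"
    by (intro integrable_integral integrable_continuous_real cont)
  from has_integral_stretch_real[OF this, of "1 / T"]
  have "((\<lambda>t. f t * cnj (h t) * of_real (w (t / T))) has_integral T *\<^sub>R integral {-1..1} ?F)
      ((\<lambda>x. x / (1 / T)) ` {-1..1})"
    using T by simp
  also have "(\<lambda>x. x / (1 / T)) ` {-1..1} = {-T..T}"
  proof (intro equalityI subsetI)
    fix t assume "t \<in> {-T..T}"
    then have "t / T \<in> {-1..1}" "t = t / T / (1 / T)"
      using T by (auto simp: field_simps)
    then show "t \<in> (\<lambda>x. x / (1 / T)) ` {-1..1}"
      by blast
  next
    fix t assume "t \<in> (\<lambda>x. x / (1 / T)) ` {-1..1}"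
    then obtain s where "\<bar>s\<bar> \<le> 1" "t = s * T"
      by (auto simp: abs_le_iff)
    then have "\<bar>t\<bar> \<le> T"
      using T mult_right_mono[of "\<bar>s\<bar>" 1 T] by (simp add: abs_mult)
    then show "t \<in> {-T..T}"
      by auto
  qed
  finally show ?thesis
    using T by (simp add: weighted_inner_def integral_unique scaleR_conv_of_real)
qed

text \<open>The factor \<open>envelope t 1\<close> in the hypothesis on \<open>f\<close> is the unrescaled signal after removal of the
  carrier; \<open>envelope T s\<close> depends only on the product \<open>T * s\<close>.\<close>

lemma (in detuned_modes) weighted_inner_eq_amplitude:
  assumes T: "T > 0" and f: "\<And>t. f t = cis (\<nu>\<^sub>1 * t) * envelope t 1"
  shows "weighted_inner w T f (\<lambda>t. cis (\<sigma> * t)) = amplitude T ((\<nu>\<^sub>1 - \<sigma>) * T)"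
proof -
  have integrand: "f (T * s) * cnj (cis (\<sigma> * (T * s))) * of_real (w s) =
      envelope T s * of_real (w s) * cis ((\<nu>\<^sub>1 - \<sigma>) * T * s)" for s
  proof -
    have "cis (\<nu>\<^sub>1 * (T * s)) * cnj (cis (\<sigma> * (T * s))) = cis ((\<nu>\<^sub>1 - \<sigma>) * T * s)"
      by (simp add: cis_cnj cis_mult algebra_simps)
    moreover have "envelope (T * s) 1 = envelope T s"
      by (simp add: envelope_def mult.assoc)
    ultimately show ?thesis
      by (simp add: f mult_ac)
  qed
  have "weighted_inner w T f (\<lambda>t. cis (\<sigma> * t)) =
      integral {-1..1} (\<lambda>s. f (T * s) * cnj (cis (\<sigma> * (T * s))) * of_real (w s) / 2)"
    by (rule weighted_inner_rescale[OF T], unfold integrand)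
      (intro continuous_intros continuous_envelope continuous_weight)
  also have "\<dots> = amplitude T ((\<nu>\<^sub>1 - \<sigma>) * T)"
    unfolding integrand amplitude_eq_trig_integral trig_integral_def by (simp add: mult_ac)
  finally show ?thesis .
qed

theorem theorem1:
  fixes w g\<^sub>0 g\<^sub>1 g\<^sub>2 :: "real \<Rightarrow> real"
    and n :: nat
    and \<nu> :: "real ^ 'd"
    and j :: 'd
    and a :: "int ^ 'd \<Rightarrow> complex"
  assumes "weight_function w"
    and "n \<ge> 1"
    and "bounded (range g\<^sub>0)" and "bounded (range g\<^sub>1)" and "bounded (range g\<^sub>2)"
    and "(\<lambda>x. weight_transform w x - g\<^sub>0 x / x ^ n) \<in> o[at_infinity](\<lambda>x. 1 / x ^ n)"
    and "(\<lambda>x. deriv (weight_transform w) x - g\<^sub>1 x / x ^ n) \<in> o[at_infinity](\<lambda>x. 1 / x ^ n)"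
    and "(\<lambda>x. deriv (deriv (weight_transform w)) x - g\<^sub>2 x / x ^ n) \<in> o[at_infinity](\<lambda>x. 1 / x ^ n)"
    and "\<And>k. k \<in> other_modes j \<Longrightarrow> a k \<noteq> 0 \<Longrightarrow> detuning \<nu> j k \<noteq> 0"
    and "\<And>p. p \<in> {0, 1, n} \<Longrightarrow>
           (\<lambda>k. cmod (a k / of_real (detuning \<nu> j k ^ p))) summable_on other_modes j"
  shows "\<exists>\<delta>\<^sub>0>0. \<forall>\<delta>. 0 < \<delta> \<and> \<delta> \<le> \<delta>\<^sub>0 \<longrightarrow>
           (\<forall>\<nu>T :: real \<Rightarrow> real.
              (\<forall>T>0. is_frequency_approx w (quasiperiodic \<nu> j a) (\<nu> $ j) \<delta> T (\<nu>T T)) \<longrightarrow>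
              (\<nu>T \<longlongrightarrow> \<nu> $ j) at_top \<and>
              (\<lambda>T. (\<nu> $ j - \<nu>T T) -
                   - 1 / (deriv (deriv (weight_transform w)) 0 * T ^ (n + 1)) *
                     (\<Sum>\<^sub>\<infinity>k\<in>other_modes j.
                        Re (a k) / detuning \<nu> j k ^ n * g\<^sub>1 (detuning \<nu> j k * T)))
                \<in> o[at_top](\<lambda>T. 1 / T ^ (n + 1)))"
proof -
  have "(\<lambda>k. cmod (a k)) summable_on other_modes j"
    using assms(10)[of 0] by simp
  then interpret detuned_modes w "other_modes j" a "detuning \<nu> j"
    using assms(1-9) by unfold_locales (auto intro: tendsto_0_if_inverse_power_expansion)
  \<comment> \<open>the choice of \<open>\<delta>\<^sub>0\<close>: every \<open>\<delta> \<le> b / 3\<close> has \<open>2 * \<delta> < b\<close>\<close>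
  have "\<forall>\<^sub>F r in at_right 0. near_mass r < 1 / 4"
    using order_tendstoD(2)[OF near_mass_tendsto_0, of "1 / 4"] by simp
  then obtain b where b: "b > 0" "\<And>r. 0 < r \<Longrightarrow> r < b \<Longrightarrow> near_mass r < 1 / 4"
    by (auto simp: eventually_at_right_field)
  show ?thesis
  proof (intro exI[of _ "b / 3"] conjI allI impI)
    show "b / 3 > 0"
      using b(1) by simp
    fix \<delta> and \<nu>T :: "real \<Rightarrow> real"
    assume \<delta>: "0 < \<delta> \<and> \<delta> \<le> b / 3"
      and approx: "\<forall>T>0. is_frequency_approx w (quasiperiodic \<nu> j a) (\<nu> $ j) \<delta> T (\<nu>T T)"
    have near: "near_mass (2 * \<delta>) \<le> 1 / 4"
      using b \<delta> by (intro less_imp_le b(2)) auto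
    define U where "U T = (\<nu> $ j - \<nu>T T) * T" for T
    have f: "quasiperiodic \<nu> j a t = cis (\<nu> $ j * t) * envelope t 1" for t
    proof -
      have "cis (pairing k \<nu> * t) = cis (\<nu> $ j * t) * cis (detuning \<nu> j k * t * 1)" for k
        by (simp add: cis_mult detuning_def algebra_simps)
      then have "(\<Sum>\<^sub>\<infinity>k\<in>other_modes j. a k * cis (pairing k \<nu> * t)) =
          (\<Sum>\<^sub>\<infinity>k\<in>other_modes j. cis (\<nu> $ j * t) * (a k * cis (detuning \<nu> j k * t * 1)))"
        by (intro infsum_cong) (simp only: mult.left_commute)
      also have "\<dots> = cis (\<nu> $ j * t) * (\<Sum>\<^sub>\<infinity>k\<in>other_modes j. a k * cis (detuning \<nu> j k * t * 1))"
        by (rule infsum_cmult_right')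
      finally show ?thesis
        unfolding quasiperiodic_def envelope_def by (simp add: distrib_left)
    qed
    note inner = weighted_inner_eq_amplitude[where f = "quasiperiodic \<nu> j a", OF _ f]
    have U_range: "\<bar>U T\<bar> \<le> \<delta> * T" if "T > 0" for T
    proof -
      have "\<bar>\<nu> $ j - \<nu>T T\<bar> \<le> \<delta>"
        using approx that by (auto simp: is_frequency_approx_def is_arg_max_def)
      then show ?thesis
        using that by (simp add: U_def abs_mult mult_right_mono)
    qed
    have U_max: "cmod (amplitude T v) \<le> cmod (amplitude T (U T))" if "T > 0" "\<bar>v\<bar> \<le> \<delta> * T" for T v
    proof -
      have "\<bar>v / T\<bar> \<le> \<delta>"
        using that by (simp add: abs_divide divide_le_eq)
      then have "\<nu> $ j - v / T \<in> {\<nu> $ j - \<delta>..\<nu> $ j + \<delta>}"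
        by (simp only: abs_le_iff atLeastAtMost_iff) linarith
      then have "cmod (weighted_inner w T (quasiperiodic \<nu> j a) (\<lambda>t. cis ((\<nu> $ j - v / T) * t)))
          \<le> cmod (weighted_inner w T (quasiperiodic \<nu> j a) (\<lambda>t. cis (\<nu>T T * t)))"
        using approx[rule_format, OF \<open>T > 0\<close>] unfolding is_frequency_approx_def is_arg_max_def not_ex
        by (simp only: de_Morgan_conj not_less) blast
      then show ?thesis
        using \<open>T > 0\<close> by (simp add: inner U_def)
    qed
    have U: "(U \<longlongrightarrow> 0) at_top"
    proof (rule maximizer_tendsto_0)
      show "\<forall>\<^sub>F T in at_top. \<bar>U T\<bar> \<le> \<delta> * T"
        using eventually_gt_at_top[of 0] by eventually_elim (rule U_range)
      show "\<forall>\<^sub>F T in at_top. cmod (amplitude T 0) \<le> cmod (amplitude T (U T))"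
        using eventually_gt_at_top[of 0] by eventually_elim (use \<delta> in \<open>auto intro: U_max\<close>)
    qed (use \<delta> near in auto)
    have "((\<lambda>T. \<nu> $ j - U T / T) \<longlongrightarrow> \<nu> $ j - 0) at_top"
      by (intro tendsto_diff tendsto_const
          real_tendsto_divide_at_top[OF U] filterlim_ident)
    moreover have "\<forall>\<^sub>F T in at_top. \<nu> $ j - U T / T = \<nu>T T"
      using eventually_gt_at_top[of 0] by eventually_elim (simp add: U_def)
    ultimately show "(\<nu>T \<longlongrightarrow> \<nu> $ j) at_top"
      unfolding diff_0_right by (rule Lim_transform_eventually)
    have expansion: "((\<lambda>T. T ^ n * U T + leading_sum n g\<^sub>1 T / \<phi>'' 0) \<longlongrightarrow> 0) at_top"
    proof (rule maximizer_expansion[OF _ assms(4) assms(7) U])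
      show "\<forall>\<^sub>F T in at_top. \<forall>v. \<bar>v\<bar> \<le> \<delta> * T \<longrightarrow> cmod (amplitude T v) \<le> cmod (amplitude T (U T))"
        using eventually_gt_at_top[of 0] by eventually_elim (auto intro: U_max)
    qed (use \<delta> assms(10)[of n] in auto)
    show "(\<lambda>T. (\<nu> $ j - \<nu>T T) -
                   - 1 / (deriv (deriv (weight_transform w)) 0 * T ^ (n + 1)) *
                     (\<Sum>\<^sub>\<infinity>k\<in>other_modes j.
                        Re (a k) / detuning \<nu> j k ^ n * g\<^sub>1 (detuning \<nu> j k * T)))
                \<in> o[at_top](\<lambda>T. 1 / T ^ (n + 1))"
      unfolding leading_sum_def[symmetric]
    proof (rule smalloI_tendsto[OF Lim_transform_eventually[OF expansion]])
      show "\<forall>\<^sub>F T in at_top. T ^ n * U T + leading_sum n g\<^sub>1 T / \<phi>'' 0 =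
          ((\<nu> $ j - \<nu>T T) - - 1 / (\<phi>'' 0 * T ^ (n + 1)) * leading_sum n g\<^sub>1 T) / (1 / T ^ (n + 1))"
        using eventually_gt_at_top[of 0]
        by eventually_elim (simp add: U_def algebra_simps)
      show "\<forall>\<^sub>F T :: real in at_top. 1 / T ^ (n + 1) \<noteq> 0"
        using eventually_gt_at_top[of 0] by eventually_elim simp
    qed
  qed
qed

end
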